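(* Suppose that the set \[ \mathcal M = \left\{ M \geq 0 : \begin{pmatrix} A - M & B^* \\ B & M \end{pmatrix} \geq 0\right\} \] is not empty. Then there exists $\hat A \leq A$ such that the set \[ \hat{\mathcal M} = \left\{ M \geq 0 : \begin{pmatrix} \hat A - M & B^* \\ B & M \end{pmatrix} \geq 0\right\} \] is a singleton.
   Context: $A$ and $B$ are bounded linear operators on a Hilbert space, with $A$ selfadjoint; the block operators act on the direct sum of two copies of that space, and $M$ ranges over positive operators on that space. *)

theory Defs
  imports "HOL-Analysis.Analysis"
begin

text \<open>A complex Hilbert space is modelled as a real Hilbert space (class
  real_inner + complete_space, inner = real part of the complex inner product)
  together with an orthogonal complex structure J (multiplication by i).
  Complex-linear bounded operators are the bounded real-linear ones commuting with J.\<close>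

definition cstruct :: "('a::real_inner \<Rightarrow>\<^sub>L 'a) \<Rightarrow> bool" where
  "cstruct J \<longleftrightarrow> (\<forall>x. J (J x) = - x) \<and> (\<forall>x y. inner (J x) (J y) = inner x y)"

definition clin :: "('a::real_inner \<Rightarrow>\<^sub>L 'a) \<Rightarrow> ('a \<Rightarrow>\<^sub>L 'a) \<Rightarrow> bool" where
  "clin J T \<longleftrightarrow> (\<forall>x. T (J x) = J (T x))"

definition adj :: "('a::{real_inner,complete_space} \<Rightarrow>\<^sub>L 'a) \<Rightarrow> ('a \<Rightarrow>\<^sub>L 'a)" where
  "adj T = (SOME S :: 'a \<Rightarrow>\<^sub>L 'a. \<forall>x y. inner (S x) y = inner x (T y))"

definition selfadj :: "('b::real_inner \<Rightarrow> 'b) \<Rightarrow> bool" where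
  "selfadj T \<longleftrightarrow> (\<forall>x y. inner (T x) y = inner x (T y))"

definition pos_op :: "('b::real_inner \<Rightarrow> 'b) \<Rightarrow> bool" where
  "pos_op T \<longleftrightarrow> selfadj T \<and> (\<forall>x. 0 \<le> inner (T x) x)"

definition op_le :: "('a::real_inner \<Rightarrow>\<^sub>L 'a) \<Rightarrow> ('a \<Rightarrow>\<^sub>L 'a) \<Rightarrow> bool" where
  "op_le S T \<longleftrightarrow> pos_op (blinfun_apply (T - S))"

definition block :: "('a::real_inner \<Rightarrow>\<^sub>L 'a) \<Rightarrow> ('a \<Rightarrow>\<^sub>L 'a) \<Rightarrow> ('a \<Rightarrow>\<^sub>L 'a) \<Rightarrow> ('a \<Rightarrow>\<^sub>L 'a)
    \<Rightarrow> ('a \<times> 'a \<Rightarrow> 'a \<times> 'a)" where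
  "block P Q R S = (\<lambda>(x, y). (P x + Q y, R x + S y))"

definition Mset :: "('a::{real_inner,complete_space} \<Rightarrow>\<^sub>L 'a) \<Rightarrow> ('a \<Rightarrow>\<^sub>L 'a) \<Rightarrow> ('a \<Rightarrow>\<^sub>L 'a)
    \<Rightarrow> ('a \<Rightarrow>\<^sub>L 'a) set" where
  "Mset J A B = {M. clin J M \<and> pos_op (blinfun_apply M) \<and> pos_op (block (A - M) (adj B) B M)}"

end

theory Submission
  imports Defs
begin

text \<open>Among the selfadjoint \<open>A' \<le> A\<close> for which the set of solutions \<open>M\<close> is nonempty there is a
  minimal one \<open>A\<^sub>0\<close>, by Zorn's lemma: balls of operators are compact in the weak operator topology, so
  chains have lower bounds. For every solution \<open>M\<close> of \<open>A\<^sub>0\<close> and every \<open>x\<close>, the infimum over \<open>y\<close> of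
  the block form at \<open>(x, y)\<close> is \<open>0\<close>; otherwise a rank one operator could be subtracted from \<open>A\<^sub>0\<close>.
  Given solutions \<open>M\<^sub>1\<close>, \<open>M\<^sub>2\<close>, apply this to their mean: both block forms are then almost \<open>0\<close> at a
  common \<open>(x, y)\<close>, which by Cauchy-Schwarz gives
  \<open>\<langle>(A\<^sub>0 - M\<^sub>i) x, x\<rangle> \<approx> - Re \<langle>B x, y\<rangle>\<close> for both \<open>i\<close>, and hence \<open>M\<^sub>1 = M\<^sub>2\<close>.\<close>

section \<open>Quadratic inequalities and minimizing sequences\<close>

lemma discriminant_le:
  fixes a b c :: real
  assumes "\<And>r. 0 \<le> a + 2 * r * b + r\<^sup>2 * c" "0 \<le> c"
  shows "b\<^sup>2 \<le> a * c"
proof (cases "c = 0")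
  case True
  have "b = 0"
  proof (rule ccontr)
    assume "b \<noteq> 0"
    \<comment> \<open>This \<open>r\<close> makes the affine expression \<open>a + 2 * r * b\<close>
      equal to -1.\<close>
    then show False
      using assms(1)[of "- (a + 1) / (2 * b)"] True by (simp add: field_simps)
  qed
  with True show ?thesis by simp
next
  case False
  with assms(2) have "c > 0" by simp
  then show ?thesis
    using assms(1)[of "- b / c"] by (simp add: field_simps power2_eq_square)
qed

lemma pos_op_Cauchy_Schwarz:
  fixes T :: "'b::real_inner \<Rightarrow> 'b"
  assumes "linear T" "pos_op T"
  shows "(inner (T x) y)\<^sup>2 \<le> inner (T x) x * inner (T y) y"
proof (rule discriminant_le)
  show "0 \<le> inner (T y) y" using assms(2) by (simp add: pos_op_def)
  have sym: "inner (T u) v = inner (T v) u" for u v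
    using assms(2) by (metis pos_op_def selfadj_def inner_commute)
  fix r :: real
  have "0 \<le> inner (T (x + r *\<^sub>R y)) (x + r *\<^sub>R y)"
    using assms(2) by (simp add: pos_op_def)
  also have "\<dots> = inner (T x) x + 2 * r * inner (T x) y + r\<^sup>2 * inner (T y) y"
    using sym[of y x]
    by (simp add: linear_add[OF assms(1)] linear_scale[OF assms(1)] inner_simps
        algebra_simps power2_eq_square)
  finally show "0 \<le> inner (T x) x + 2 * r * inner (T x) y + r\<^sup>2 * inner (T y) y" .
qed

text \<open>The parallelogram identity yields bounds of this shape for points whose values exceed an
  infimum by less than \<open>inverse (Suc n)\<close>. The estimate serves both for a minimizing
  sequence and for its image under an operator.\<close>

lemma convergent_if_dist_le:
  fixes X :: "nat \<Rightarrow> 'b::complete_space"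
  assumes "\<And>m n. (dist (X m) (X n))\<^sup>2 \<le> K * (inverse (Suc m) + inverse (Suc n))"
  shows "\<exists>l. X \<longlonglongrightarrow> l"
proof -
  have "Cauchy X"
  proof (rule metric_CauchyI)
    fix e :: real assume "e > 0"
    have "(\<lambda>n. \<bar>K\<bar> * (2 * inverse (real (Suc n)))) \<longlonglongrightarrow> \<bar>K\<bar> * (2 * 0)"
      by (intro tendsto_intros LIMSEQ_inverse_real_of_nat)
    then have "\<forall>\<^sub>F n in sequentially. \<bar>K\<bar> * (2 * inverse (real (Suc n))) < e\<^sup>2"
      by (rule order_tendstoD) (use \<open>e > 0\<close> in simp)
    then obtain N where N: "\<bar>K\<bar> * (2 * inverse (real (Suc N))) < e\<^sup>2"
      by (auto simp: eventually_sequentially)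
    have "dist (X m) (X n) < e" if "m \<ge> N" "n \<ge> N" for m n
    proof -
      have "(dist (X m) (X n))\<^sup>2 \<le> K * (inverse (Suc m) + inverse (Suc n))" by (rule assms)
      also have "\<dots> \<le> \<bar>K\<bar> * (inverse (Suc m) + inverse (Suc n))"
        by (intro mult_right_mono) auto
      also have "\<dots> \<le> \<bar>K\<bar> * (inverse (Suc N) + inverse (Suc N))"
        using that by (intro mult_left_mono add_mono) (auto simp: field_simps)
      also have "\<dots> < e\<^sup>2" using N by simp
      finally show ?thesis using \<open>e > 0\<close> by (simp add: power2_less_imp_less)
    qed
    then show "\<exists>M. \<forall>m\<ge>M. \<forall>n\<ge>M. dist (X m) (X n) < e" by blast
  qed
  then show ?thesis by (metis Cauchy_convergent_iff convergent_def)
qed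

lemma minimizing_sequence:
  fixes f :: "'b \<Rightarrow> real"
  assumes "S \<noteq> {}" "bdd_below (f ` S)"
  obtains X where "\<And>n. X n \<in> S" "\<And>n. f (X n) < Inf (f ` S) + inverse (real (Suc n))"
proof -
  have "\<exists>x\<in>S. f x < Inf (f ` S) + inverse (real (Suc n))" for n
    using cInf_lessD[of "f ` S" "Inf (f ` S) + inverse (real (Suc n))"] assms(1) by auto
  then show ?thesis using that by metis
qed

section \<open>Riesz representation of functionals and bilinear forms\<close>

text \<open>If \<open>w\<close> represents \<phi>, then \<open>q v\<close> is the squared distance
  from \<open>v\<close> to \<open>w\<close> minus the squared norm of \<open>w\<close>. So the
  vector is found by minimizing \<open>q\<close>, and completeness provides the minimizer.\<close>

lemma riesz_representation:
  fixes \<phi> :: "'b::{real_inner,complete_space} \<Rightarrow> real"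
  assumes "bounded_linear \<phi>"
  shows "\<exists>v. \<forall>x. \<phi> x = inner v x"
proof -
  interpret bounded_linear \<phi> by fact
  define q where "q = (\<lambda>v. inner v v - 2 * \<phi> v)"
  obtain K where K: "\<And>x. \<bar>\<phi> x\<bar> \<le> norm x * K" using bounded by auto
  have "- K\<^sup>2 \<le> q v" for v
  proof -
    have "0 \<le> (norm v - K)\<^sup>2" by simp
    then show ?thesis using K[of v] by (simp add: q_def power2_diff algebra_simps flip: power2_norm_eq_inner)
  qed
  then have bdd: "bdd_below (range q)" by (auto simp: bdd_below_def)
  define m where "m = Inf (range q)"
  have m: "m \<le> q v" for v unfolding m_def by (rule cInf_lower) (use bdd in auto)
  obtain X where X: "\<And>n. q (X n) < m + inverse (real (Suc n))"
    using minimizing_sequence[OF _ bdd] unfolding m_def by auto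
  \<comment> \<open>Parallelogram law; the linear part of \<open>q\<close> cancels. Near-minimizers
    are therefore close to each other.\<close>
  have par: "(norm (u - v))\<^sup>2 = 2 * q u + 2 * q v - 4 * q ((1/2) *\<^sub>R (u + v))" for u v
    by (simp add: q_def power2_norm_eq_inner add scale inner_simps inner_commute algebra_simps)
  have "(dist (X i) (X j))\<^sup>2 \<le> 2 * (inverse (Suc i) + inverse (Suc j))" for i j
    using par[of "X i" "X j"] X[of i] X[of j] m[of "(1/2) *\<^sub>R (X i + X j)"]
    by (simp add: dist_norm)
  then obtain v where v: "X \<longlonglongrightarrow> v" using convergent_if_dist_le by blast
  have "q v \<le> m"
  proof (rule LIMSEQ_le)
    show "(\<lambda>n. q (X n)) \<longlonglongrightarrow> q v" unfolding q_def by (intro tendsto_intros tendsto v)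
    show "(\<lambda>n. m + inverse (real (Suc n))) \<longlonglongrightarrow> m" by (rule LIMSEQ_inverse_real_of_nat_add)
    show "\<exists>N. \<forall>n\<ge>N. q (X n) \<le> m + inverse (real (Suc n))" using X less_imp_le by blast
  qed
  \<comment> \<open>The first variation vanishes at the minimizer \<open>v\<close>: the nonnegative
    quadratic in \<open>r\<close> has constant term 0, so its linear coefficient is 0.\<close>
  have "(inner v x - \<phi> x)\<^sup>2 \<le> 0 * inner x x" for x
  proof (rule discriminant_le)
    fix r
    have "0 \<le> q (v + r *\<^sub>R x) - q v" using m[of "v + r *\<^sub>R x"] \<open>q v \<le> m\<close> by simp
    also have "\<dots> = 0 + 2 * r * (inner v x - \<phi> x) + r\<^sup>2 * inner x x"
      by (simp add: q_def add scale inner_simps inner_commute algebra_simps power2_eq_square)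
    finally show "0 \<le> 0 + 2 * r * (inner v x - \<phi> x) + r\<^sup>2 * inner x x" .
  qed simp
  then show ?thesis by (metis mult_zero_left power2_less_eq_zero_iff eq_iff_diff_eq_0)
qed

text \<open>For fixed \<open>x\<close> the Riesz vector of \<open>f x\<close> defines
  \<open>T x\<close>. Its uniqueness makes \<open>T\<close> linear, and testing against
  \<open>y = T x\<close> bounds the norm.\<close>

lemma riesz_bounded_bilinear:
  fixes f :: "'b::{real_inner,complete_space} \<Rightarrow> 'b \<Rightarrow> real"
  assumes lin: "\<And>y. linear (\<lambda>x. f x y)" "\<And>x. linear (f x)"
    and bd: "\<And>x y. \<bar>f x y\<bar> \<le> C * norm x * norm y" and "0 \<le> C"
  shows "\<exists>T :: 'b \<Rightarrow>\<^sub>L 'b. norm T \<le> C \<and> (\<forall>x y. f x y = inner (blinfun_apply T x) y)"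
proof -
  have "\<exists>v. \<forall>y. f x y = inner v y" for x
  proof (rule riesz_representation, rule bounded_linear_intro)
    show "norm (f x y) \<le> norm y * (C * norm x)" for y
      using bd[of x y] by (simp add: mult_ac)
  qed (simp_all add: linear_add[OF lin(2)] linear_scale[OF lin(2)])
  then obtain T where T: "\<And>x y. f x y = inner (T x) y" by metis
  have n: "norm (T x) \<le> C * norm x" for x
  proof (cases "T x = 0")
    case False
    have "norm (T x) * norm (T x) \<le> C * norm x * norm (T x)"
      using bd[of x "T x"] by (simp add: T flip: power2_norm_eq_inner power2_eq_square)
    with False show ?thesis by simp
  qed (use \<open>0 \<le> C\<close> in simp)
  have "bounded_linear T"
  proof (rule bounded_linear_intro)
    show "T (x + y) = T x + T y" for x y
      by (rule vector_eq_rdot[THEN iffD1], rule)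
        (simp add: inner_add_left linear_add[OF lin(1)] flip: T)
    show "T (r *\<^sub>R x) = r *\<^sub>R T x" for r x
      by (rule vector_eq_rdot[THEN iffD1], rule)
        (simp add: linear_scale[OF lin(1)] flip: T)
    show "norm (T x) \<le> norm x * C" for x using n[of x] by (simp add: mult_ac)
  qed
  then have "norm (Blinfun T) \<le> C \<and> (\<forall>x y. f x y = inner (blinfun_apply (Blinfun T) x) y)"
    using n \<open>0 \<le> C\<close> by (auto simp: bounded_linear_Blinfun_apply T intro!: norm_blinfun_bound)
  then show ?thesis by blast
qed

section \<open>Rank one minorants of positive forms\<close>

text \<open>If the Schur complement of \<open>T\<close> along \<open>V\<close> does not vanish at \<open>z\<close>, then \<open>e\<close>, its value at \<open>z\<close>,
  is the limit of \<open>T w\<close> along a minimizing sequence \<open>w\<close> of the form on \<open>z + V\<close>. The sequence \<open>w\<close>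
  itself need not converge.\<close>
lemma pos_op_dominates_rank_one:
  fixes T :: "'b::{real_inner,complete_space} \<Rightarrow> 'b"
  assumes "bounded_linear T" "pos_op T" "subspace V"
    and "0 < s" "\<And>v. v \<in> V \<Longrightarrow> s \<le> inner (T (z + v)) (z + v)"
  shows "\<exists>e c. e \<noteq> 0 \<and> 0 < c \<and> (\<forall>v\<in>V. inner e v = 0) \<and> (\<forall>w. c * (inner e w)\<^sup>2 \<le> inner (T w) w)"
proof -
  interpret bounded_linear T by fact
  define t where "t = (\<lambda>w. inner (T w) w)"
  have t0: "0 \<le> t w" for w using assms(2) by (simp add: t_def pos_op_def)
  have sym: "inner (T u) v = inner (T v) u" for u v
    using assms(2) by (metis pos_op_def selfadj_def inner_commute)
  have CS: "(inner (T u) v)\<^sup>2 \<le> t u * t v" for u v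
    unfolding t_def by (rule pos_op_Cauchy_Schwarz) (use assms(2) linear in auto)
  define S where "S = (\<lambda>v. z + v) ` V"
  have "S \<noteq> {}" using subspace_0[OF assms(3)] by (auto simp: S_def)
  have bdd: "bdd_below (t ` S)" using t0 by (auto simp: bdd_below_def)
  define m where "m = Inf (t ` S)"
  have m: "m \<le> t w" if "w \<in> S" for w unfolding m_def by (rule cInf_lower) (use bdd that in auto)
  have "s \<le> m" unfolding m_def
    by (rule cInf_greatest) (use \<open>S \<noteq> {}\<close> assms(5) in \<open>auto simp: S_def t_def\<close>)
  obtain X where XS: "\<And>n. X n \<in> S" and X: "\<And>n. t (X n) < m + inverse (real (Suc n))"
    using minimizing_sequence[OF \<open>S \<noteq> {}\<close> bdd] unfolding m_def by auto
  \<comment> \<open>Midpoints stay in the affine set, so the parallelogram identity can be compared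
    with the infimum \<open>m\<close>.\<close>
  have mid: "(1/2) *\<^sub>R (X i + X j) \<in> S" for i j
  proof -
    obtain u v where "X i = z + u" "X j = z + v" "u \<in> V" "v \<in> V" using XS by (metis S_def imageE)
    moreover have "(1/2) *\<^sub>R (u + v) \<in> V"
      using calculation assms(3) by (simp add: subspace_add subspace_scale)
    moreover have "(1/2) *\<^sub>R ((z + u) + (z + v)) = z + (1/2) *\<^sub>R (u + v)"
      using scaleR_half_double[of z] by (simp add: scaleR_add_right add_ac)
    ultimately show ?thesis by (auto simp: S_def)
  qed
  have par: "t (u - v) = 2 * t u + 2 * t v - 4 * t ((1/2) *\<^sub>R (u + v))" for u v
    using sym[of u v] by (simp add: t_def add diff scale inner_simps algebra_simps)
  have tdiff: "t (X i - X j) \<le> 2 * (inverse (Suc i) + inverse (Suc j))" for i j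
    using par[of "X i" "X j"] X[of i] X[of j] m[OF mid[of i j]] by simp
  obtain K where K: "K > 0" "\<And>w. norm (T w) \<le> norm w * K" using pos_bounded by auto
  \<comment> \<open>Cauchy-Schwarz for the form at \<open>w\<close> and \<open>T w\<close> turns
    smallness of \<open>t w\<close> into smallness of \<open>T w\<close> in norm. This makes
    \<open>T (X n)\<close> Cauchy.\<close>
  have TT: "(norm (T w))\<^sup>2 \<le> K * t w" for w
  proof (cases "T w = 0")
    case False
    have "(norm (T w))\<^sup>2 * (norm (T w))\<^sup>2 = (inner (T w) (T w))\<^sup>2"
      by (simp add: power2_norm_eq_inner) (simp add: power2_eq_square)
    also have "\<dots> \<le> t w * t (T w)" by (rule CS)
    also have "\<dots> \<le> t w * (norm (T w) * K * norm (T w))"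
    proof (intro mult_left_mono t0)
      have "t (T w) \<le> norm (T (T w)) * norm (T w)" unfolding t_def by (rule norm_cauchy_schwarz)
      also have "\<dots> \<le> norm (T w) * K * norm (T w)" by (intro mult_right_mono K) simp
      finally show "t (T w) \<le> norm (T w) * K * norm (T w)" .
    qed
    finally have "(norm (T w))\<^sup>2 * (norm (T w))\<^sup>2 \<le> K * t w * (norm (T w))\<^sup>2"
      by (simp add: power2_eq_square mult_ac)
    then show ?thesis by (rule mult_right_le_imp_le) (use False in simp)
  qed (use t0 K in simp)
  have "(dist (T (X i)) (T (X j)))\<^sup>2 \<le> (2 * K) * (inverse (Suc i) + inverse (Suc j))" for i j
  proof -
    have "(dist (T (X i)) (T (X j)))\<^sup>2 \<le> K * t (X i - X j)"
      using TT[of "X i - X j"] by (simp add: dist_norm diff)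
    also have "\<dots> \<le> K * (2 * (inverse (Suc i) + inverse (Suc j)))"
      using tdiff K(1) by (intro mult_left_mono) auto
    finally show ?thesis by (simp only: mult_ac)
  qed
  then obtain e where e: "(\<lambda>n. T (X n)) \<longlonglongrightarrow> e"
    using convergent_if_dist_le[of "\<lambda>n. T (X n)"] by blast
  have lim_m: "(\<lambda>n. m + inverse (real (Suc n))) \<longlonglongrightarrow> m" by (rule LIMSEQ_inverse_real_of_nat_add)
  \<comment> \<open>Moving from \<open>X n\<close> along \<open>v\<close> stays in \<open>S\<close>
    and can lower \<open>t\<close> by at most \<open>t (X n) - m\<close>, which tends to 0; so the
    linear term vanishes in the limit.\<close>
  have "inner e v = 0" if "v \<in> V" for v
  proof -
    have "(inner (T (X n)) v)\<^sup>2 \<le> inverse (Suc n) * t v" for n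
    proof -
      have "(inner (T (X n)) v)\<^sup>2 \<le> (t (X n) - m) * t v"
      proof (rule discriminant_le[OF _ t0])
        fix r
        have "X n + r *\<^sub>R v \<in> S" using XS[of n] that assms(3)
          by (auto simp: S_def add.assoc subspace_add subspace_scale)
        from m[OF this] show "0 \<le> (t (X n) - m) + 2 * r * inner (T (X n)) v + r\<^sup>2 * t v"
          using sym[of v "X n"]
          by (simp add: t_def add scale inner_simps algebra_simps power2_eq_square)
      qed
      also have "\<dots> \<le> inverse (Suc n) * t v" using X[of n] t0 by (intro mult_right_mono) auto
      finally show ?thesis .
    qed
    moreover have "(\<lambda>n. (inner (T (X n)) v)\<^sup>2) \<longlonglongrightarrow> (inner e v)\<^sup>2" by (intro tendsto_intros e)
    moreover have "(\<lambda>n. inverse (Suc n) * t v) \<longlonglongrightarrow> 0 * t v"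
      by (intro tendsto_intros LIMSEQ_inverse_real_of_nat)
    ultimately have "(inner e v)\<^sup>2 \<le> 0 * t v" using LIMSEQ_le by blast
    then show ?thesis by simp
  qed
  \<comment> \<open>Cauchy-Schwarz with \<open>t (X n)\<close> tending to \<open>m\<close>; hence
    the constant \<open>c = inverse m\<close> at the end.\<close>
  moreover have "(inner e w)\<^sup>2 \<le> m * t w" for w
  proof (rule LIMSEQ_le)
    show "(\<lambda>n. (inner (T (X n)) w)\<^sup>2) \<longlonglongrightarrow> (inner e w)\<^sup>2" by (intro tendsto_intros e)
    show "(\<lambda>n. (m + inverse (real (Suc n))) * t w) \<longlonglongrightarrow> m * t w" by (intro tendsto_intros lim_m)
    have "(inner (T (X n)) w)\<^sup>2 \<le> (m + inverse (real (Suc n))) * t w" for n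
      by (rule order_trans[OF CS]) (use X[of n] t0 in \<open>intro mult_right_mono, auto\<close>)
    then show "\<exists>N. \<forall>n\<ge>N. (inner (T (X n)) w)\<^sup>2 \<le> (m + inverse (real (Suc n))) * t w" by blast
  qed
  \<comment> \<open>For fixed \<open>k\<close>, polarization and \<open>tdiff\<close> keep the limit
    of \<open>inner (T (X n)) (X k)\<close> above \<open>m - inverse (Suc k)\<close>, which is
    positive for large \<open>k\<close>.\<close>
  moreover have "e \<noteq> 0"
  proof -
    have "m > 0" using assms(4) \<open>s \<le> m\<close> by simp
    then obtain k where k: "inverse (real (Suc k)) < m" using reals_Archimedean by blast
    have "m - inverse (Suc k) - inverse (Suc n) \<le> inner (T (X n)) (X k)" for n
    proof -
      have "t (X k - X n) = t (X k) - 2 * inner (T (X n)) (X k) + t (X n)"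
        using sym[of "X k" "X n"] by (simp add: t_def diff inner_simps)
      then show ?thesis using tdiff[of k n] m[OF XS, of k] m[OF XS, of n] by simp
    qed
    moreover have "(\<lambda>n. inner (T (X n)) (X k)) \<longlonglongrightarrow> inner e (X k)" by (intro tendsto_intros e)
    moreover have "(\<lambda>n. m - inverse (Suc k) - inverse (Suc n)) \<longlonglongrightarrow> m - inverse (Suc k) - 0"
      by (intro tendsto_intros LIMSEQ_inverse_real_of_nat)
    ultimately have "m - inverse (Suc k) - 0 \<le> inner e (X k)" using LIMSEQ_le by blast
    with k show ?thesis by auto
  qed
  moreover have "0 < inverse m" using assms(4) \<open>s \<le> m\<close> by simp
  ultimately show ?thesis unfolding t_def
    by (intro exI[of _ e] exI[of _ "inverse m"]) (auto simp: field_simps)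
qed

section \<open>Weak operator compactness\<close>

text \<open>As a real function on pairs, an operator inherits the product topology of the function
  type; pointwise convergence of these forms is weak operator convergence.\<close>

definition op_form :: "('b::real_inner \<Rightarrow>\<^sub>L 'b) \<Rightarrow> 'b \<times> 'b \<Rightarrow> real" where
  "op_form T = (\<lambda>p. inner (T (fst p)) (snd p))"

text \<open>Tychonoff makes the product \<open>P\<close> of intervals compact, and bilinearity is a
  closed condition. The bilinear forms in \<open>P\<close> are exactly those of operators in the
  ball, by \<open>riesz_bounded_bilinear\<close>.\<close>

lemma compact_op_forms:
  assumes "0 \<le> C"
  shows "compact (op_form ` {T :: 'b::{real_inner,complete_space} \<Rightarrow>\<^sub>L 'b. norm T \<le> C})"
proof -
  define P where "P = (\<Pi>\<^sub>E p\<in>(UNIV :: ('b \<times> 'b) set).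
    {- (C * norm (fst p) * norm (snd p)) .. C * norm (fst p) * norm (snd p)})"
  define L where "L = {f :: 'b \<times> 'b \<Rightarrow> real.
     (\<forall>x x' y. f (x + x', y) = f (x, y) + f (x', y)) \<and> (\<forall>r x y. f (r *\<^sub>R x, y) = r * f (x, y)) \<and>
     (\<forall>x y y'. f (x, y + y') = f (x, y) + f (x, y')) \<and> (\<forall>r x y. f (x, r *\<^sub>R y) = r * f (x, y))}"
  have "compactin (product_topology (\<lambda>_. euclidean) UNIV) P"
    unfolding P_def compactin_PiE by simp
  then have "compact P" by (simp add: euclidean_product_topology)
  moreover have "closed L"
    unfolding L_def
    by (intro closed_Collect_conj closed_Collect_all closed_Collect_eq continuous_intros
        continuous_on_product_coordinates)
  moreover have "op_form ` {T :: 'b \<Rightarrow>\<^sub>L 'b. norm T \<le> C} = P \<inter> L"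
  proof (intro equalityI subsetI)
    fix f assume "f \<in> op_form ` {T :: 'b \<Rightarrow>\<^sub>L 'b. norm T \<le> C}"
    then obtain T :: "'b \<Rightarrow>\<^sub>L 'b" where T: "norm T \<le> C" "f = op_form T" by auto
    have "\<bar>inner (T x) y\<bar> \<le> C * norm x * norm y" for x y
    proof -
      have "\<bar>inner (T x) y\<bar> \<le> norm (T x) * norm y" by (rule Cauchy_Schwarz_ineq2)
      also have "\<dots> \<le> C * norm x * norm y"
        using norm_blinfun[of T x] T(1) by (meson mult_right_mono norm_ge_zero order_trans)
      finally show ?thesis .
    qed
    then show "f \<in> P \<inter> L"
      unfolding T(2) P_def L_def op_form_def
      by (auto simp: abs_le_iff minus_le_iff blinfun.add_right blinfun.scaleR_right inner_simps)
  next
    fix f assume f: "f \<in> P \<inter> L"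
    have "\<exists>T :: 'b \<Rightarrow>\<^sub>L 'b. norm T \<le> C \<and> (\<forall>x y. f (x, y) = inner (blinfun_apply T x) y)"
    proof (rule riesz_bounded_bilinear[OF _ _ _ \<open>0 \<le> C\<close>])
      show "\<bar>f (x, y)\<bar> \<le> C * norm x * norm y" for x y
      proof -
        have "f (x, y) \<in> {- (C * norm (fst (x, y)) * norm (snd (x, y))) ..
            C * norm (fst (x, y)) * norm (snd (x, y))}"
          using f unfolding P_def by (intro PiE_mem[of f UNIV]) auto
        then show ?thesis by (auto simp: abs_le_iff)
      qed
    qed (use f in \<open>auto simp: L_def intro!: linearI\<close>)
    then show "f \<in> op_form ` {T :: 'b \<Rightarrow>\<^sub>L 'b. norm T \<le> C}"
      by (force simp: op_form_def image_iff)
  qed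
  ultimately show ?thesis by (simp add: compact_Int_closed)
qed

section \<open>Operators controlled by their quadratic forms\<close>

text \<open>Cauchy-Schwarz for the form of \<open>S\<close> at \<open>x\<close> and
  \<open>S x\<close> bounds the fourth power of \<open>norm (S x)\<close> by a product of two form
  values, both controlled by \<open>A\<close>. This keeps chains and their solutions in a fixed
  ball.\<close>

lemma norm_le_if_pos_op_le:
  fixes S A :: "'b::real_inner \<Rightarrow>\<^sub>L 'b"
  assumes "pos_op (blinfun_apply S)" "\<And>x. inner (S x) x \<le> inner (A x) x"
  shows "norm S \<le> norm A"
proof (rule norm_blinfun_bound)
  fix x
  have form_le: "inner (S y) y \<le> norm A * (norm y)\<^sup>2" for y
  proof -
    have "inner (S y) y \<le> norm (A y) * norm y"
      using assms(2)[of y] norm_cauchy_schwarz[of "A y" y] by linarith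
    also have "\<dots> \<le> norm A * norm y * norm y" by (intro mult_right_mono norm_blinfun) simp
    finally show ?thesis by (simp add: power2_eq_square mult_ac)
  qed
  show "norm (S x) \<le> norm A * norm x"
  proof (cases "S x = 0")
    case False
    have "((norm (S x))\<^sup>2)\<^sup>2 = (inner (S x) (S x))\<^sup>2" by (simp add: power2_norm_eq_inner)
    also have "\<dots> \<le> inner (S x) x * inner (S (S x)) (S x)"
      by (rule pos_op_Cauchy_Schwarz[OF _ assms(1)]) (rule bounded_linear.linear[OF blinfun.bounded_linear_right])
    also have "\<dots> \<le> (norm A * (norm x)\<^sup>2) * (norm A * (norm (S x))\<^sup>2)"
      using assms(1) by (intro mult_mono form_le) (auto simp: pos_op_def)
    finally have "(norm (S x))\<^sup>2 * (norm (S x))\<^sup>2 \<le> (norm A * norm x)\<^sup>2 * (norm (S x))\<^sup>2"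
      by (simp add: power2_eq_square mult_ac)
    then have "(norm (S x))\<^sup>2 \<le> (norm A * norm x)\<^sup>2"
      by (rule mult_right_le_imp_le) (use False in simp)
    then show ?thesis by (rule power2_le_imp_le) simp
  qed simp
qed simp

text \<open>The form of \<open>S - T\<close> vanishes, so \<open>S - T\<close> is positive and
  dominated by 0.\<close>

lemma eq_if_forms_eq:
  fixes S T :: "'b::real_inner \<Rightarrow>\<^sub>L 'b"
  assumes "selfadj (blinfun_apply S)" "selfadj (blinfun_apply T)"
    and "\<And>x. inner (S x) x = inner (T x) x"
  shows "S = T"
proof -
  have "pos_op (blinfun_apply (S - T))"
    using assms by (simp add: pos_op_def selfadj_def blinfun.diff_left inner_simps)
  then have "norm (S - T) \<le> norm (0 :: 'b \<Rightarrow>\<^sub>L 'b)"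
    by (rule norm_le_if_pos_op_le) (simp add: assms(3) blinfun.diff_left inner_simps)
  then show ?thesis by simp
qed

lemma op_le_iff:
  assumes "selfadj (blinfun_apply S)" "selfadj (blinfun_apply T)"
  shows "op_le S T \<longleftrightarrow> (\<forall>x. inner (S x) x \<le> inner (T x) x)"
  using assms by (simp add: op_le_def pos_op_def selfadj_def blinfun.diff_left inner_simps)

section \<open>The complex structure and the block form\<close>

lemma cstruct_inner:
  assumes "cstruct J"
  shows "inner (J x) y = - inner x (J y)"
proof -
  have "inner (J x) (J (J y)) = inner x (J y)" "J (J y) = - y"
    using assms unfolding cstruct_def by blast+
  then have "- inner (J x) y = inner x (J y)" by simp
  then show ?thesis by linarith
qed

text \<open>Expressed through matrix entries, commutation with \<open>J\<close> survives pointwise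
  limits of forms.\<close>

lemma clin_iff:
  assumes "cstruct J"
  shows "clin J T \<longleftrightarrow> (\<forall>x y. inner (T (J x)) y = - inner (T x) (J y))"
proof -
  have "clin J T \<longleftrightarrow> (\<forall>x y. inner (T (J x)) y = inner (J (T x)) y)"
    unfolding clin_def by (metis vector_eq_rdot)
  then show ?thesis by (simp add: cstruct_inner[OF assms])
qed

text \<open>The existence of the adjoint, on which the \<open>SOME\<close> in \<^const>\<open>adj\<close> depends, is not needed here:
  selfadjointness of the block operator already forces the adjoint identity.\<close>
lemma adj_if_Mset:
  assumes "M \<in> Mset J A B"
  shows "inner (adj B y) x = inner y (B x)"
proof -
  have "selfadj (block (A - M) (adj B) B M)"
    using assms by (simp add: Mset_def pos_op_def)
  then have "inner (block (A - M) (adj B) B M (0, y)) (x, 0)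
      = inner (0, y) (block (A - M) (adj B) B M (x, 0))"
    unfolding selfadj_def by blast
  then show ?thesis by (simp add: block_def)
qed

lemma block_form:
  assumes "\<And>x y. inner (adj B y) x = inner y (B x)"
  shows "inner (block (A - M) (adj B) B M (x, y)) (x, y)
    = inner (A x) x - inner (M x) x + 2 * inner (B x) y + inner (M y) y"
  using assms by (simp add: block_def inner_simps blinfun.diff_left inner_commute)

text \<open>Block positivity becomes a family of scalar inequalities affine in \<open>A\<close> and
  \<open>M\<close>, suited to averaging and to limits.\<close>

lemma Mset_iff:
  assumes adj: "\<And>x y. inner (adj B y) x = inner y (B x)" and A: "selfadj (blinfun_apply A)"
  shows "M \<in> Mset J A B \<longleftrightarrow> clin J M \<and> pos_op (blinfun_apply M) \<and>
    (\<forall>x y. 0 \<le> inner (A x) x - inner (M x) x + 2 * inner (B x) y + inner (M y) y)"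
proof -
  have "selfadj (block (A - M) (adj B) B M)" if "selfadj (blinfun_apply M)"
    using A that adj
    by (auto simp: selfadj_def block_def inner_simps blinfun.diff_left)
      (metis add.commute inner_commute)
  then show ?thesis
    by (auto simp: Mset_def pos_op_def[of "block _ _ _ _"] block_form[OF adj] pos_op_def)
qed

section \<open>Lowering \<open>A\<close> when the Schur complement does not vanish\<close>

text \<open>The block form is at least \<open>s\<close> on
  \<open>(x0, 0) + {0} \<times> UNIV\<close>, so it dominates a rank one form. The vector of that
  form is orthogonal to \<open>{0} \<times> UNIV\<close>; hence only the first coordinate enters,
  and the rank one form can be taken out of the corner \<open>A\<close>.\<close>

lemma Mset_reducible:
  fixes J A B M :: "'a::{real_inner,complete_space} \<Rightarrow>\<^sub>L 'a"
  assumes J: "cstruct J" and A: "clin J A" "selfadj (blinfun_apply A)" and B: "clin J B"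
    and M: "M \<in> Mset J A B"
    and "0 < s"
    and s: "\<And>y. s \<le> inner (A x0) x0 - inner (M x0) x0 + 2 * inner (B x0) y + inner (M y) y"
  shows "\<exists>D. D \<noteq> 0 \<and> clin J D \<and> pos_op (blinfun_apply D) \<and> M \<in> Mset J (A - D) B"
proof -
  note adj = adj_if_Mset[OF M]
  have JJ: "J (J x) = - x" for x using J by (simp add: cstruct_def)
  have Jin: "inner (J x) (J y) = inner x y" for x y using J by (simp add: cstruct_def)
  have "clin J M" using M by (simp add: Mset_def)
  define T where "T = block (A - M) (adj B) B M"
  note form = block_form[OF adj, of A M, folded T_def]
  have "bounded_linear T"
    unfolding T_def block_def case_prod_beta
    by (intro bounded_linear_Pair bounded_linear_add
        bounded_linear_compose[OF blinfun.bounded_linear_right] bounded_linear_fst bounded_linear_snd)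
  moreover have "pos_op T" using M by (simp add: T_def Mset_def)
  moreover have "subspace ({0 :: 'a} \<times> (UNIV :: 'a set))" by (simp add: subspace_Times)
  moreover have "s \<le> inner (T ((x0, 0) + v)) ((x0, 0) + v)" if "v \<in> {0} \<times> UNIV" for v
    using that s by (auto simp: form)
  ultimately obtain e' c where "e' \<noteq> 0" "0 < c" and e'0: "\<forall>v\<in>{0} \<times> UNIV. inner e' v = 0"
    and e': "\<forall>w. c * (inner e' w)\<^sup>2 \<le> inner (T w) w"
    using pos_op_dominates_rank_one[of T "{0} \<times> UNIV" s "(x0, 0)"] \<open>0 < s\<close> by blast
  define e where "e = fst e'"
  have "inner e' (0, snd e') = 0" using e'0 by blast
  then have "snd e' = 0" by (simp add: inner_prod_def)
  then have "e \<noteq> 0" using \<open>e' \<noteq> 0\<close> by (auto simp: e_def prod_eq_iff)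
  define t where "t = (\<lambda>x y. inner (A x) x - inner (M x) x + 2 * inner (B x) y + inner (M y) y)"
  have e: "c * (inner e x)\<^sup>2 \<le> t x y" for x y
  proof -
    have "inner e' (x, y) = inner e x" using \<open>snd e' = 0\<close> by (simp add: inner_prod_def e_def)
    then show ?thesis using e'[rule_format, of "(x, y)"] by (simp only: form t_def)
  qed
  \<comment> \<open>Invariance of the block form under \<open>J\<close> carries the bound for
    \<open>e\<close> over to \<open>J e\<close>; the factor \<open>c / 2\<close> in \<open>D\<close>
    averages the two bounds.\<close>
  have "t (J x) (J y) = t x y" for x y
    using A(1) B \<open>clin J M\<close> by (simp add: t_def clin_def Jin)
  then have Je: "c * (inner (J e) x)\<^sup>2 \<le> t x y" for x y
    using e[of "J x" "J y"] by (simp add: cstruct_inner[OF J])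
  \<comment> \<open>\<open>x \<mapsto> \<langle>e, x\<rangle> e\<close> alone is only real-linear; the \<open>J e\<close> term makes \<open>D\<close> commute with \<open>J\<close>.\<close>
  define D where "D = (c / 2) *\<^sub>R ((blinfun_scaleR_left e o\<^sub>L blinfun_inner_right e) +
      (blinfun_scaleR_left (J e) o\<^sub>L blinfun_inner_right (J e)))"
  have D: "D x = (c / 2) *\<^sub>R (inner e x *\<^sub>R e + inner (J e) x *\<^sub>R J e)" for x
    by (simp add: D_def blinfun.bilinear_simps)
  have Dform: "inner (D x) x = (c / 2) * ((inner e x)\<^sup>2 + (inner (J e) x)\<^sup>2)" for x
    by (simp add: D inner_simps power2_eq_square)
  have "clin J D"
    unfolding clin_def
    by (simp add: D blinfun.bilinear_simps JJ Jin cstruct_inner[OF J, of e] algebra_simps)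
  moreover have "pos_op (blinfun_apply D)"
    using \<open>0 < c\<close> unfolding pos_op_def selfadj_def Dform
    by (auto simp: D inner_simps inner_commute algebra_simps)
  moreover have "D \<noteq> 0"
  proof
    assume "D = 0"
    then have "(c / 2) * ((inner e e)\<^sup>2 + (inner (J e) e)\<^sup>2) = 0" using Dform[of e] by simp
    with \<open>0 < c\<close> \<open>e \<noteq> 0\<close> show False by (simp add: add_nonneg_eq_0_iff)
  qed
  moreover have "M \<in> Mset J (A - D) B"
  proof -
    have "selfadj (blinfun_apply (A - D))"
      using A(2) \<open>pos_op (blinfun_apply D)\<close>
      by (simp add: pos_op_def selfadj_def blinfun.diff_left inner_simps)
    moreover have "inner (D x) x \<le> t x y" for x y
      using e[of x y] Je[of x y] by (simp add: Dform algebra_simps)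
    ultimately show ?thesis
      using M by (simp add: Mset_iff[OF adj] A(2) blinfun.diff_left inner_simps t_def algebra_simps)
  qed
  ultimately show ?thesis by blast
qed

section \<open>Uniqueness when the Schur complement vanishes\<close>

text \<open>\<open>irred\<close> denies the lower bound \<open>s\<close> of
  \<open>Mset_reducible\<close>. It is asked of every solution because it is applied to the mean of
  \<open>M1\<close> and \<open>M2\<close>.\<close>

lemma Mset_unique_if_irreducible:
  fixes J A B :: "'a::{real_inner,complete_space} \<Rightarrow>\<^sub>L 'a"
  assumes A: "selfadj (blinfun_apply A)"
    and M: "M1 \<in> Mset J A B" "M2 \<in> Mset J A B"
    and irred: "\<And>M x s. \<lbrakk>M \<in> Mset J A B; 0 < s\<rbrakk> \<Longrightarrow>
      \<exists>y. inner (A x) x - inner (M x) x + 2 * inner (B x) y + inner (M y) y < s"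
  shows "M1 = M2"
proof (rule eq_if_forms_eq)
  note iff = Mset_iff[OF adj_if_Mset[OF M(1)] A]
  define t where "t = (\<lambda>M x y. inner (A x) x - inner (blinfun_apply M x) x
    + 2 * inner (B x) y + inner (M y) y)"
  have t0: "0 \<le> t M x y" if "M \<in> Mset J A B" for M x y
    using that by (simp add: iff t_def)
  define n where "n = (\<lambda>M x. inner (A x) x - inner (blinfun_apply M x) x)"
  have n0: "0 \<le> n M x" if "M \<in> Mset J A B" for M x
    using t0[OF that, of x 0] by (simp add: t_def n_def)
  \<comment> \<open>This is the discriminant inequality
    \<open>(inner (B x) y)\<^sup>2 \<le> n M x * inner (M y) y\<close> with
    \<open>(n M x)\<^sup>2 + 2 * n M x * inner (B x) y\<close> added to both sides.\<close>
  have key: "(n M x + inner (B x) y)\<^sup>2 \<le> t M x y * n M x" if "M \<in> Mset J A B" for M x y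
  proof -
    have "(inner (B x) y)\<^sup>2 \<le> n M x * inner (M y) y"
    proof (rule discriminant_le)
      show "0 \<le> n M x + 2 * r * inner (B x) y + r\<^sup>2 * inner (M y) y" for r
        using t0[OF that, of x "r *\<^sub>R y"]
        by (simp add: t_def n_def blinfun.scaleR_right power2_eq_square mult_ac)
      show "0 \<le> inner (M y) y" using that by (simp add: iff pos_op_def)
    qed
    moreover have "t M x y = n M x + 2 * inner (B x) y + inner (M y) y"
      by (simp add: t_def n_def)
    ultimately show ?thesis by (simp add: power2_eq_square algebra_simps)
  qed
  \<comment> \<open>\<open>t\<close> is affine in the operator and nonnegative on solutions, so
    where the mean has a small value both \<open>M1\<close> and \<open>M2\<close> do.\<close>
  define M where "M = (1/2) *\<^sub>R (M1 + M2)"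
  have MS: "M \<in> Mset J A B"
  proof -
    have "t M x y = (t M1 x y + t M2 x y) / 2" for x y
      by (simp add: M_def t_def blinfun.bilinear_simps inner_simps field_simps)
    from this t0[OF M(1)] t0[OF M(2)] have "0 \<le> t M x y" for x y
      by (metis add_nonneg_nonneg divide_nonneg_nonneg zero_le_numeral)
    moreover have "clin J M" using M
      by (simp add: Mset_def clin_def M_def blinfun.bilinear_simps)
    moreover have "pos_op (blinfun_apply M)" using M
      by (auto simp: iff pos_op_def selfadj_def M_def blinfun.bilinear_simps inner_add_left
          inner_add_right intro!: add_nonneg_nonneg)
    ultimately show ?thesis by (simp add: iff t_def)
  qed
  show "selfadj (blinfun_apply M1)" "selfadj (blinfun_apply M2)"
    using M by (auto simp: iff pos_op_def)
  fix x
  have "(n M1 x - n M2 x)\<^sup>2 \<le> \<epsilon>" if "0 < \<epsilon>" for \<epsilon>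
  proof -
    \<comment> \<open>\<open>N\<close> dominates \<open>n M1 x\<close> and \<open>n M2 x\<close>,
      and the summand 1 makes it positive. The 4 absorbs a factor 2 from splitting the square and a
      factor 2 from averaging.\<close>
    define N where "N = n M1 x + n M2 x + 1"
    have "N > 0" using n0[OF M(1), of x] n0[OF M(2), of x] by (simp add: N_def)
    with that have "0 < \<epsilon> / (4 * N)" by simp
    then obtain y where y: "t M x y < \<epsilon> / (4 * N)"
      using irred[OF MS, of "\<epsilon> / (4 * N)" x] unfolding t_def by blast
    have avg: "t M1 x y + t M2 x y = 2 * t M x y"
      by (simp add: M_def t_def blinfun.bilinear_simps inner_simps field_simps)
    have "(n M1 x - n M2 x)\<^sup>2 \<le> 2 * (n M1 x + inner (B x) y)\<^sup>2 + 2 * (n M2 x + inner (B x) y)\<^sup>2"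
    proof -
      have "0 \<le> ((n M1 x + inner (B x) y) + (n M2 x + inner (B x) y))\<^sup>2" by simp
      then show ?thesis by (simp add: power2_eq_square algebra_simps)
    qed
    also have "\<dots> \<le> 2 * (t M1 x y * N) + 2 * (t M2 x y * N)"
    proof -
      have "t M1 x y * n M1 x \<le> t M1 x y * N" "t M2 x y * n M2 x \<le> t M2 x y * N"
        using n0[OF M(1), of x] n0[OF M(2), of x] t0 M
        by (auto intro!: mult_left_mono simp: N_def)
      with key[OF M(1), of x y] key[OF M(2), of x y] show ?thesis by linarith
    qed
    also have "\<dots> = (t M1 x y + t M2 x y) * (2 * N)" by (simp add: algebra_simps)
    also have "\<dots> = t M x y * (4 * N)" by (simp add: avg)
    also have "\<dots> \<le> \<epsilon>" using y \<open>N > 0\<close> by (simp add: field_simps)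
    finally show ?thesis .
  qed
  then have "(n M1 x - n M2 x)\<^sup>2 \<le> 0" by (rule field_le_epsilon[of _ 0, simplified])
  then show "inner (M1 x) x = inner (M2 x) x" by (simp add: n_def)
qed

section \<open>Lower bounds of chains and minimal feasible operators\<close>

lemma finite_chain_lower_bound:
  fixes P :: "'c \<Rightarrow> 'c \<Rightarrow> bool"
  assumes "finite F" "F \<noteq> {}" "F \<subseteq> C"
    and "\<And>a b. a \<in> C \<Longrightarrow> b \<in> C \<Longrightarrow> P a b \<or> P b a"
    and "\<And>a b c. \<lbrakk>a \<in> C; b \<in> C; c \<in> C; P a b; P b c\<rbrakk> \<Longrightarrow> P a c"
  shows "\<exists>a\<in>F. \<forall>b\<in>F. P a b"
  using assms(1-3)
proof (induction rule: finite_ne_induct)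
  case (singleton x)
  then show ?case using assms(4)[of x x] by auto
next
  case (insert x F)
  then obtain a where a: "a \<in> F" "\<forall>b\<in>F. P a b" by auto
  have C: "x \<in> C" "F \<subseteq> C" "a \<in> C" using insert.prems a by auto
  show ?case
  proof (cases "P a x")
    case False
    then have "P x a" using assms(4) C by blast
    moreover have "P x x" using assms(4) C by blast
    moreover have "P x b" if "b \<in> F" for b
      using assms(5)[of x a b] a C that \<open>P x a\<close> by blast
    ultimately show ?thesis by blast
  qed (use a in auto)
qed

definition feasible :: "('a::{real_inner,complete_space} \<Rightarrow>\<^sub>L 'a) \<Rightarrow> ('a \<Rightarrow>\<^sub>L 'a) \<Rightarrow> ('a \<Rightarrow>\<^sub>L 'a) set" where
  "feasible J B = {A. clin J A \<and> selfadj (blinfun_apply A) \<and> Mset J A B \<noteq> {}}"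

text \<open>Pairs of a chain member and one of its solutions have a cluster point in a compact set.
  Carrying the solution along keeps the limit feasible.\<close>

lemma feasible_chain_lower_bound:
  fixes J B :: "'a::{real_inner,complete_space} \<Rightarrow>\<^sub>L 'a"
  assumes J: "cstruct J" and "C \<subseteq> feasible J B" "C \<noteq> {}"
    and chain: "\<And>S T. S \<in> C \<Longrightarrow> T \<in> C \<Longrightarrow> op_le S T \<or> op_le T S"
  shows "\<exists>A0\<in>feasible J B. \<forall>A\<in>C. op_le A0 A"
proof -
  obtain A1 where "A1 \<in> C" using assms(3) by auto
  have C: "clin J A" "selfadj (blinfun_apply A)" "Mset J A B \<noteq> {}" if "A \<in> C" for A
    using that assms(2) by (auto simp: feasible_def)
  note le_iff = op_le_iff[OF C(2) C(2)]
  obtain M1 where "M1 \<in> Mset J A1 B" using C(3) \<open>A1 \<in> C\<close> by auto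
  note adj = adj_if_Mset[OF this]
  note iff = Mset_iff[OF adj]
  define K where "K = op_form ` {T :: 'a \<Rightarrow>\<^sub>L 'a. norm T \<le> norm A1}"
  have "compact (K \<times> K)" unfolding K_def by (intro compact_Times compact_op_forms) auto
  define S where "S = (\<lambda>A. {(op_form A', op_form M) | A' M.
    A' \<in> C \<and> op_le A' A \<and> op_le A' A1 \<and> M \<in> Mset J A' B})"
  have SK: "S A \<subseteq> K \<times> K" for A
  proof -
    \<comment> \<open>Here \<open>0 \<le> M \<le> A' \<le> A1\<close> in the operator order; the
      middle inequality is the block inequality at \<open>y = 0\<close>.\<close>
    have "norm A' \<le> norm A1 \<and> norm M \<le> norm A1"
      if A': "A' \<in> C" "op_le A' A1" and M: "M \<in> Mset J A' B" for A' M
    proof -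
      have le: "inner (A' x) x \<le> inner (A1 x) x" for x
        using le_iff[OF A'(1) \<open>A1 \<in> C\<close>] A'(2) by blast
      have M': "pos_op (blinfun_apply M)"
        and t: "0 \<le> inner (A' x) x - inner (M x) x + 2 * inner (B x) y + inner (M y) y" for x y
        using M by (auto simp: iff[OF C(2)[OF A'(1)]])
      have MA: "inner (M x) x \<le> inner (A' x) x" for x using t[of x 0] by simp
      then have "pos_op (blinfun_apply A')"
        using C(2)[OF A'(1)] M' by (meson order_trans pos_op_def)
      then show ?thesis using norm_le_if_pos_op_le M' le MA by (meson order_trans)
    qed
    then show ?thesis by (auto simp: S_def K_def)
  qed
  have "(K \<times> K) \<inter> (\<Inter>A\<in>C. closure (S A)) \<noteq> {}"
  proof (rule compact_imp_fip_image[OF \<open>compact (K \<times> K)\<close>])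
    fix F assume F: "finite F" "F \<subseteq> C"
    \<comment> \<open>The least of finitely many chain members, paired with any of its solutions,
      lies in each \<open>S A\<close>. Adding \<open>A1\<close> covers the empty \<open>F\<close>
      and secures the clause \<open>op_le A' A1\<close>.\<close>
    have "\<exists>A\<in>insert A1 F. \<forall>A'\<in>insert A1 F. op_le A A'"
    proof (rule finite_chain_lower_bound[of _ C])
      show "op_le S U" if "S \<in> C" "T \<in> C" "U \<in> C" "op_le S T" "op_le T U" for S T U
        using that by (meson le_iff order_trans)
    qed (use F \<open>A1 \<in> C\<close> chain in auto)
    then obtain A where A: "A \<in> insert A1 F" "\<forall>A'\<in>insert A1 F. op_le A A'" by blast
    then have "A \<in> C" using F \<open>A1 \<in> C\<close> by auto
    then obtain M where "M \<in> Mset J A B" using C(3) by auto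
    then have "(op_form A, op_form M) \<in> S A'" if "A' \<in> insert A1 F" for A'
      using A that \<open>A \<in> C\<close> by (auto simp: S_def)
    then have "(op_form A, op_form M) \<in> (K \<times> K) \<inter> (\<Inter>A\<in>F. closure (S A))"
      using SK[of A1] closure_subset by blast
    then show "(K \<times> K) \<inter> (\<Inter>A\<in>F. closure (S A)) \<noteq> {}" by blast
  qed simp
  then obtain A0 M0 where cl: "\<And>A. A \<in> C \<Longrightarrow> (op_form A0, op_form M0) \<in> closure (S A)"
    by (auto simp: K_def)
  \<comment> \<open>A closed condition that holds on the chain below some \<open>A\<close> passes to
    the cluster point. The conditions used below involve finitely many coordinates each, so they are
    closed.\<close>
  have limit: "Q (op_form A0, op_form M0)"
    if "closed {p. Q p}" "A \<in> C"
      "\<And>A' M. \<lbrakk>A' \<in> C; op_le A' A; M \<in> Mset J A' B\<rbrakk> \<Longrightarrow> Q (op_form A', op_form M)" for Q A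
  proof -
    have "S A \<subseteq> {p. Q p}" using that(3) by (auto simp: S_def)
    then show ?thesis using closure_minimal[OF _ that(1)] cl[OF that(2)] by blast
  qed
  have cont: "continuous_on UNIV (\<lambda>p::('a \<times> 'a \<Rightarrow> real) \<times> ('a \<times> 'a \<Rightarrow> real). fst p z)"
    "continuous_on UNIV (\<lambda>p::('a \<times> 'a \<Rightarrow> real) \<times> ('a \<times> 'a \<Rightarrow> real). snd p z)" for z
    by (rule continuous_on_product_then_coordinatewise; intro continuous_intros)+
  have A0sa: "selfadj (blinfun_apply A0)"
  proof -
    have "op_form A0 (x, y) = op_form A0 (y, x)" for x y
      using limit[OF _ \<open>A1 \<in> C\<close>, of "\<lambda>p. fst p (x, y) = fst p (y, x)"] C(2)
      by (simp add: op_form_def selfadj_def inner_commute closed_Collect_eq cont)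
    then show ?thesis by (simp add: op_form_def selfadj_def inner_commute)
  qed
  have "clin J A0"
  proof -
    have "op_form A0 (J x, y) = - op_form A0 (x, J y)" for x y
      using limit[OF _ \<open>A1 \<in> C\<close>, of "\<lambda>p. fst p (J x, y) = - fst p (x, J y)"] C(1)
      by (simp add: op_form_def clin_iff[OF J] closed_Collect_eq cont continuous_on_minus)
    then show ?thesis by (simp add: op_form_def clin_iff[OF J])
  qed
  have "clin J M0"
  proof -
    have "op_form M0 (J x, y) = - op_form M0 (x, J y)" for x y
      using limit[OF _ \<open>A1 \<in> C\<close>, of "\<lambda>p. snd p (J x, y) = - snd p (x, J y)"]
      by (simp add: op_form_def Mset_def clin_iff[OF J] closed_Collect_eq cont continuous_on_minus)
    then show ?thesis by (simp add: op_form_def clin_iff[OF J])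
  qed
  have "pos_op (blinfun_apply M0)"
  proof -
    have "op_form M0 (x, y) = op_form M0 (y, x)" for x y
      using limit[OF _ \<open>A1 \<in> C\<close>, of "\<lambda>p. snd p (x, y) = snd p (y, x)"]
      by (simp add: op_form_def Mset_def pos_op_def selfadj_def inner_commute closed_Collect_eq cont)
    moreover have "0 \<le> op_form M0 (x, x)" for x
      using limit[OF _ \<open>A1 \<in> C\<close>, of "\<lambda>p. 0 \<le> snd p (x, x)"]
      by (simp add: op_form_def Mset_def pos_op_def closed_Collect_le cont)
    ultimately show ?thesis by (simp add: op_form_def pos_op_def selfadj_def inner_commute)
  qed
  moreover have "0 \<le> inner (A0 x) x - inner (M0 x) x + 2 * inner (B x) y + inner (M0 y) y" for x y
  proof -
    define Q where "Q = (\<lambda>p. 0 \<le> fst p (x, x) - snd p (x, x) + 2 * inner (B x) y + snd p (y, y))"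
    have "closed {p. Q p}" unfolding Q_def
      by (intro closed_Collect_le continuous_on_add continuous_on_diff continuous_on_const cont)
    moreover have "Q (op_form A', op_form M)" if "A' \<in> C" "M \<in> Mset J A' B" for A' M
      using that iff[OF C(2)[OF that(1)]] by (simp add: Q_def op_form_def)
    ultimately have "Q (op_form A0, op_form M0)" using limit \<open>A1 \<in> C\<close> by blast
    then show ?thesis by (simp add: Q_def op_form_def)
  qed
  ultimately have "M0 \<in> Mset J A0 B" using \<open>clin J M0\<close> iff[OF A0sa] by blast
  then have "A0 \<in> feasible J B" using \<open>clin J A0\<close> A0sa by (auto simp: feasible_def)
  \<comment> \<open>\<open>S A\<close> contains only chain members below \<open>A\<close>, so its
    cluster point is below \<open>A\<close> too.\<close>
  moreover have "op_le A0 A" if "A \<in> C" for A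
  proof -
    have "op_form A0 (x, x) \<le> op_form A (x, x)" for x
      using limit[OF _ that, of "\<lambda>p. fst p (x, x) \<le> op_form A (x, x)"] le_iff[OF _ that]
      by (simp add: op_form_def closed_Collect_le cont)
    then show ?thesis using op_le_iff[OF A0sa C(2)[OF that]] by (simp add: op_form_def)
  qed
  ultimately show ?thesis by blast
qed

lemma ex_minimal_feasible:
  fixes J A B :: "'a::{real_inner,complete_space} \<Rightarrow>\<^sub>L 'a"
  assumes J: "cstruct J" and A: "A \<in> feasible J B"
  shows "\<exists>Ah\<in>feasible J B. op_le Ah A \<and> (\<forall>A'\<in>feasible J B. op_le A' Ah \<longrightarrow> A' = Ah)"
proof -
  define F where "F = {A' \<in> feasible J B. op_le A' A}"
  have sa: "selfadj (blinfun_apply S)" if "S \<in> feasible J B" for S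
    using that by (simp add: feasible_def)
  note le_iff = op_le_iff[OF sa sa]
  have refl: "op_le S S" if "S \<in> feasible J B" for S using that by (simp add: le_iff)
  have trans: "op_le S U"
    if "S \<in> feasible J B" "T \<in> feasible J B" "U \<in> feasible J B" "op_le S T" "op_le T U" for S T U
    using that by (meson le_iff order_trans)
  have antisym: "S = T" if "S \<in> feasible J B" "T \<in> feasible J B" "op_le S T" "op_le T S" for S T
    using that by (intro eq_if_forms_eq sa) (auto simp: le_iff intro: antisym)
  \<comment> \<open>\<open>predicate_Zorn\<close> produces maximal elements, so it is applied to the
    reversed order.\<close>
  have "\<exists>m\<in>F. \<forall>a\<in>F. op_le a m \<longrightarrow> a = m"
  proof (rule predicate_Zorn[where P = "\<lambda>S T. op_le T S"])
    show "partial_order_on F (relation_of (\<lambda>S T. op_le T S) F)"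
    proof (rule partial_order_on_relation_ofI)
      show "op_le S S" if "S \<in> F" for S using that refl by (simp add: F_def)
      show "op_le U S" if "S \<in> F" "T \<in> F" "U \<in> F" "op_le T S" "op_le U T" for S T U
        using that trans[of U T S] by (simp add: F_def)
      show "S = T" if "S \<in> F" "T \<in> F" "op_le T S" "op_le S T" for S T
        using that antisym[of S T] by (simp add: F_def)
    qed
  next
    fix C assume "C \<in> Chains (relation_of (\<lambda>S T. op_le T S) F)"
    then have C: "C \<subseteq> F" "\<And>S T. S \<in> C \<Longrightarrow> T \<in> C \<Longrightarrow> op_le S T \<or> op_le T S"
      by (auto simp: Chains_def relation_of_def)
    show "\<exists>u\<in>F. \<forall>a\<in>C. op_le u a"
    proof (cases "C = {}")
      case True
      then show ?thesis using A refl by (auto simp: F_def)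
    next
      case False
      have "C \<subseteq> feasible J B" using C(1) by (auto simp: F_def)
      then obtain A0 where A0: "A0 \<in> feasible J B" "\<forall>T\<in>C. op_le A0 T"
        using feasible_chain_lower_bound[OF J _ False C(2)] by blast
      moreover obtain T where "T \<in> C" using False by auto
      ultimately have "op_le A0 A" using trans[of A0 T A] A C(1) by (auto simp: F_def)
      with A0 show ?thesis by (auto simp: F_def)
    qed
  qed
  then obtain Ah where Ah: "Ah \<in> F" "\<And>A'. A' \<in> F \<Longrightarrow> op_le A' Ah \<Longrightarrow> A' = Ah" by blast
  \<comment> \<open>\<open>F\<close> is downward closed in \<open>feasible J B\<close>, so
    minimality in \<open>F\<close> is minimality among all feasible operators.\<close>
  have "A' = Ah" if "A' \<in> feasible J B" "op_le A' Ah" for A'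
    using that trans[of A' Ah A] A Ah by (simp add: F_def)
  with Ah(1) show ?thesis by (auto simp: F_def)
qed

theorem theorem4p3:
  fixes J A B :: "'a::{real_inner,complete_space} \<Rightarrow>\<^sub>L 'a"
  assumes "cstruct J" and "clin J A" and "clin J B"
    and "selfadj (blinfun_apply A)"
    and "Mset J A B \<noteq> {}"
  shows "\<exists>Ah. clin J Ah \<and> selfadj (blinfun_apply Ah) \<and> op_le Ah A \<and> (\<exists>M. Mset J Ah B = {M})"
proof -
  have "A \<in> feasible J B" using assms by (simp add: feasible_def)
  then obtain Ah where Ah: "Ah \<in> feasible J B" "op_le Ah A"
    and min: "\<And>A'. A' \<in> feasible J B \<Longrightarrow> op_le A' Ah \<Longrightarrow> A' = Ah"
    using ex_minimal_feasible[OF assms(1)] by blast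
  have Ah': "clin J Ah" "selfadj (blinfun_apply Ah)" "Mset J Ah B \<noteq> {}"
    using Ah(1) by (auto simp: feasible_def)
  have "\<exists>y. inner (Ah x) x - inner (M x) x + 2 * inner (B x) y + inner (M y) y < s"
    if M: "M \<in> Mset J Ah B" "0 < s" for M x s
  proof (rule ccontr)
    assume "\<not> ?thesis"
    then obtain D where D: "D \<noteq> 0" "clin J D" "pos_op (blinfun_apply D)" "M \<in> Mset J (Ah - D) B"
      using Mset_reducible[OF assms(1) Ah'(1,2) assms(3) M, of x] by (meson not_less)
    \<comment> \<open>\<open>M\<close> itself remains a solution for \<open>Ah - D\<close>, so this
      operator is feasible and contradicts the minimality of \<open>Ah\<close>.\<close>
    have "Ah - D \<in> feasible J B"
      using D Ah' by (auto simp: feasible_def clin_def pos_op_def selfadj_def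
          blinfun.bilinear_simps inner_simps)
    moreover have "op_le (Ah - D) Ah" using D(3) by (simp add: op_le_def)
    ultimately show False using min D(1) by force
  qed
  then have "M1 = M2" if "M1 \<in> Mset J Ah B" "M2 \<in> Mset J Ah B" for M1 M2
    using Mset_unique_if_irreducible[OF Ah'(2) that] by blast
  then have "\<exists>M. Mset J Ah B = {M}" using Ah'(3) by blast
  then show ?thesis using Ah' Ah(2) by blast
qed

end
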